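(* Let $p$ be a prime, $K$ an algebraically closed field of characteristic $p$, $q$ a power of $p$, and $n\ge 1$. The map $\Lambda\mapsto Z(\Lambda)$ from the set of radical $K\{\tau\}$-submodules of $\Lambda_n$ to the set of $q$-varieties contained in $K^n$, and the map $F\mapsto M(F)$ from the set of $q$-varieties contained in $K^n$ to the set of radical $K\{\tau\}$-submodules of $\Lambda_n$, are mutually inverse bijections.
   Context: $\mathbb{F}_q\subset K$ is the subfield with $q$ elements. $K\{\tau\}$ is the set of $\mathbb{F}_q$-linear polynomials $\sum_{i=0}^d a_iX^{q^i}$ ($a_i\in K$), a non-commutative ring under addition and composition; $\tau$ denotes $X^q$, so $\tau^i=X^{q^i}$. With indeterminates $X_1,\dots,X_n$, $\Lambda_n$ is the set of polynomials $\sum_{i=1}^n P_i(X_i)$ with $P_i\in K\{\tau\}$; it is a free left $K\{\tau\}$-module of rank $n$ via $P\cdot f=P\circ f$. For $S\subset\Lambda_n$, $Z(S)=\{x\in K^n: f(x)=0\ \forall f\in S\}$; a set of this form is called a $q$-variety. For $F\subset K^n$, $M(F)=\{f\in\Lambda_n: f(x)=0\ \forall x\in F\}$ (a submodule). For a submodule $\Lambda\subset\Lambda_n$, $\mathrm{Rad}(\Lambda)=\{f\in\Lambda_n:\exists N\in\mathbb{N},\ \tau^N f\in\Lambda\}$, and $\Lambda$ is radical if $\mathrm{Rad}(\Lambda)=\Lambda$. *)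

theory Defs
  imports
    "HOL-Analysis.Finite_Cartesian_Product"
    "HOL-Library.Poly_Mapping"
    "HOL-Computational_Algebra.Computational_Algebra"
begin

text \<open>
  Multivariate polynomials over \<open>'a\<close> in indeterminates indexed by the finite type \<open>'n\<close>:
  finitely supported maps from exponent vectors to coefficients, with the convolution product.
  The number \<open>n\<close> of indeterminates is \<open>CARD('n)\<close>, and \<open>K\<^sup>n\<close> is \<open>'a ^ 'n\<close>.
\<close>

type_synonym ('a, 'n) mpol = "('n \<Rightarrow>\<^sub>0 nat) \<Rightarrow>\<^sub>0 'a"

definition mconst :: "'a::comm_ring_1 \<Rightarrow> ('a, 'n) mpol" where
  "mconst c = Poly_Mapping.single 0 c"

definition mvar :: "'n \<Rightarrow> ('a::comm_ring_1, 'n) mpol" where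
  "mvar i = Poly_Mapping.single (Poly_Mapping.single i 1) 1"

definition meval :: "('a::comm_ring_1, 'n::finite) mpol \<Rightarrow> 'a ^ 'n \<Rightarrow> 'a" where
  "meval f x =
    (\<Sum>m\<in>Poly_Mapping.keys f.
       Poly_Mapping.lookup f m * (\<Prod>i\<in>UNIV. (x $ i) ^ Poly_Mapping.lookup m i))"

text \<open>
  The composition \<open>P \<circ> f\<close>: the univariate polynomial \<open>P\<close> is evaluated at the element \<open>f\<close> of the
  multivariate polynomial ring. In particular \<open>msubst P (mvar i)\<close> is \<open>P(X\<^sub>i)\<close>.
\<close>

definition msubst :: "'a::comm_ring_1 poly \<Rightarrow> ('a, 'n) mpol \<Rightarrow> ('a, 'n) mpol" where
  "msubst P f = poly (map_poly mconst P) f"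

definition tau_pow :: "nat \<Rightarrow> nat \<Rightarrow> 'a::comm_ring_1 poly" where
  "tau_pow q i = monom 1 (q ^ i)"

text \<open>The set \<open>K{\<tau>}\<close>; its ring multiplication is composition of polynomials.\<close>

definition K_tau :: "nat \<Rightarrow> 'a::comm_ring_1 poly set" where
  "K_tau q = {P. \<exists>d a. P = (\<Sum>i\<le>d. smult (a i) (tau_pow q i))}"

definition Lam :: "nat \<Rightarrow> ('a::comm_ring_1, 'n::finite) mpol set" where
  "Lam q = {f. \<exists>P. (\<forall>i. P i \<in> K_tau q) \<and> f = (\<Sum>i\<in>UNIV. msubst (P i) (mvar i))}"

text \<open>
  Closure under negation is not listed separately because \<open>-f\<close> is the composition of \<open>-X\<close> with \<open>f\<close>,
  and \<open>-X\<close> lies in \<open>K{\<tau>}\<close>.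
\<close>

definition K_tau_submodule :: "nat \<Rightarrow> ('a::comm_ring_1, 'n::finite) mpol set \<Rightarrow> bool" where
  "K_tau_submodule q L \<longleftrightarrow>
     L \<subseteq> Lam q \<and> 0 \<in> L \<and>
     (\<forall>f\<in>L. \<forall>g\<in>L. f + g \<in> L) \<and>
     (\<forall>P\<in>K_tau q. \<forall>f\<in>L. msubst P f \<in> L)"

definition Rad :: "nat \<Rightarrow> ('a::comm_ring_1, 'n::finite) mpol set \<Rightarrow> ('a, 'n) mpol set" where
  "Rad q L = {f \<in> Lam q. \<exists>N. msubst (tau_pow q N) f \<in> L}"

definition radical_submodule :: "nat \<Rightarrow> ('a::comm_ring_1, 'n::finite) mpol set \<Rightarrow> bool" where
  "radical_submodule q L \<longleftrightarrow> K_tau_submodule q L \<and> Rad q L = L"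

definition Zset :: "('a::comm_ring_1, 'n::finite) mpol set \<Rightarrow> ('a ^ 'n) set" where
  "Zset S = {x. \<forall>f\<in>S. meval f x = 0}"

definition q_variety :: "nat \<Rightarrow> ('a::comm_ring_1 ^ 'n::finite) set \<Rightarrow> bool" where
  "q_variety q F \<longleftrightarrow> (\<exists>S. S \<subseteq> Lam q \<and> F = Zset S)"

definition Mmod :: "nat \<Rightarrow> ('a::comm_ring_1 ^ 'n::finite) set \<Rightarrow> ('a, 'n) mpol set" where
  "Mmod q F = {f \<in> Lam q. \<forall>x\<in>F. meval f x = 0}"

end

theory Submission
  imports Defs
begin

text \<open>
  Right division makes every left ideal of \<open>K{\<tau>}\<close> principal, and since \<open>K\<close> is algebraically closed
  every nonzero element of \<open>K{\<tau>}\<close> acts surjectively on \<open>K\<close>. So \<open>K\<close> is an injective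
  \<open>K{\<tau>}\<close>-module, by the usual argument for divisible modules over a principal ideal domain.
  Let \<open>f\<close> lie outside \<open>Rad(\<Lambda>)\<close> and let \<open>D\<close> generate the left ideal of all \<open>P\<close> with \<open>P \<circ> f \<in> \<Lambda>\<close>.
  Then \<open>D\<close> is not of the form \<open>c\<tau>\<^sup>N\<close>, so it has a root \<open>z \<noteq> 0\<close>, and the homomorphism that
  kills \<open>\<Lambda>\<close> and sends \<open>f\<close> to \<open>z\<close> extends to all of \<open>\<Lambda>\<^sub>n\<close>. A homomorphism \<open>\<Lambda>\<^sub>n \<rightarrow> K\<close> is
  evaluation at the point formed by the images of the \<open>X\<^sub>i\<close>; that point lies in \<open>Z(\<Lambda>)\<close> and
  \<open>f\<close> does not vanish there.
\<close>

section \<open>Evaluation and substitution of multivariate polynomials\<close>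

lemma poly_mapping_sum_single:
  "f = (\<Sum>k\<in>Poly_Mapping.keys f. Poly_Mapping.single k (Poly_Mapping.lookup f k))"
  by (rule poly_mapping_eqI)
    (auto simp: lookup_sum lookup_single when_def in_keys_iff sum.delta)

text \<open>Allows the evaluations of \<open>f\<close>, \<open>g\<close> and \<open>f + g\<close> to
  be summed over one common index set.\<close>

lemma meval_superset:
  assumes "finite A" "Poly_Mapping.keys f \<subseteq> A"
  shows "meval f x =
    (\<Sum>m\<in>A. Poly_Mapping.lookup f m * (\<Prod>i\<in>UNIV. (x $ i) ^ Poly_Mapping.lookup m i))"
  unfolding meval_def using assms
  by (intro sum.mono_neutral_left) (auto simp: in_keys_iff)

lemma meval_0 [simp]: "meval 0 x = 0"
  by (simp add: meval_def)

lemma meval_single: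
  "meval (Poly_Mapping.single m c) x = c * (\<Prod>i\<in>UNIV. (x $ i) ^ Poly_Mapping.lookup m i)"
  by (subst meval_superset[of "{m}"]) auto

lemma meval_mconst [simp]: "meval (mconst c) x = c"
  by (simp add: mconst_def meval_single)

lemma meval_mvar [simp]: "meval (mvar i) x = x $ i"
proof -
  have "(\<Prod>j\<in>UNIV. (x $ j) ^ Poly_Mapping.lookup (Poly_Mapping.single i (1::nat)) j)
      = (\<Prod>j\<in>UNIV. if j = i then x $ j else 1)"
    by (intro prod.cong) (auto simp: lookup_single when_def)
  then show ?thesis
    by (simp add: mvar_def meval_single)
qed

lemma meval_add [simp]: "meval (f + g) x = meval f x + meval g x"
proof -
  let ?A = "Poly_Mapping.keys f \<union> Poly_Mapping.keys g"
  have "Poly_Mapping.keys (f + g) \<subseteq> ?A"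
    by (rule keys_add)
  then show ?thesis
    by (simp add: meval_superset[of ?A] lookup_add algebra_simps sum.distrib)
qed

lemma meval_sum [simp]: "meval (\<Sum>a\<in>A. f a) x = (\<Sum>a\<in>A. meval (f a) x)"
  by (induction A rule: infinite_finite_induct) auto

text \<open>Both sides are additive in each factor, so it is enough to compare them on monomials,
  where exponents add.\<close>

lemma meval_mult [simp]: "meval (f * g) x = meval f x * meval g x"
proof -
  have single: "meval (Poly_Mapping.single a c * Poly_Mapping.single b d) x
      = meval (Poly_Mapping.single a c) x * meval (Poly_Mapping.single b d) x" for a b c d
    by (simp add: mult_single meval_single lookup_add power_add prod.distrib)
  have "f * g = (\<Sum>k\<in>Poly_Mapping.keys f. Poly_Mapping.single k (Poly_Mapping.lookup f k)) *
      (\<Sum>k\<in>Poly_Mapping.keys g. Poly_Mapping.single k (Poly_Mapping.lookup g k))"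
    by (simp flip: poly_mapping_sum_single)
  then have "meval (f * g) x =
      meval (\<Sum>k\<in>Poly_Mapping.keys f. Poly_Mapping.single k (Poly_Mapping.lookup f k)) x *
      meval (\<Sum>k\<in>Poly_Mapping.keys g. Poly_Mapping.single k (Poly_Mapping.lookup g k)) x"
    by (simp only: meval_sum sum_product single)
  then show ?thesis
    by (simp flip: poly_mapping_sum_single)
qed

lemma mconst_0 [simp]: "mconst 0 = 0"
  by (simp add: mconst_def)

lemma mconst_1 [simp]: "mconst 1 = 1"
  by (simp add: mconst_def)

lemma mconst_add: "mconst (a + b) = mconst a + mconst b"
  by (simp add: mconst_def single_add)

lemma mconst_mult: "mconst (a * b) = mconst a * mconst b"
  by (simp add: mconst_def mult_single)

lemma msubst_0 [simp]: "msubst 0 f = 0"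
  by (simp add: msubst_def)

lemma msubst_pCons: "msubst (pCons a P) f = mconst a + f * msubst P f"
  by (simp add: msubst_def map_poly_pCons)

lemma msubst_X [simp]: "msubst [:0, 1:] f = f"
  by (simp add: msubst_pCons)

lemma msubst_add:
  fixes f :: "('a::comm_ring_1, 'n) mpol"
  shows "msubst (P + Q) f = msubst P f + msubst Q f"
proof -
  have "map_poly mconst (P + Q) = map_poly mconst P + (map_poly mconst Q :: ('a, 'n) mpol poly)"
    by (intro poly_eqI) (simp add: coeff_map_poly mconst_add)
  then show ?thesis
    by (simp add: msubst_def)
qed

lemma msubst_smult: "msubst (smult c P) f = mconst c * msubst P f"
  by (simp add: msubst_def map_poly_smult mconst_mult)

lemma msubst_mult: "msubst (P * Q) f = msubst P f * msubst Q f"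
  by (induction P) (simp_all add: msubst_pCons msubst_add msubst_smult algebra_simps)

text \<open>Associativity of the module action, since the product in \<open>K{\<tau>}\<close> is
  \<open>pcompose\<close>.\<close>

lemma msubst_pcompose: "msubst (pcompose P Q) f = msubst P (msubst Q f)"
  by (induction P) (simp_all add: msubst_pCons pcompose_pCons msubst_add msubst_mult)

lemma msubst_tau_pow: "msubst (tau_pow q i) f = f ^ (q ^ i)"
  by (simp add: msubst_def tau_pow_def map_poly_monom poly_monom)

lemma meval_msubst [simp]: "meval (msubst P f) x = poly P (meval f x)"
  by (induction P) (simp_all add: msubst_pCons)

lemma msubst_minus: "msubst (- P) f = - msubst P f"
  using msubst_add[of "- P" P f] by (simp add: eq_neg_iff_add_eq_0)

text \<open>Lets the Frobenius identity be used in the multivariate polynomial ring as well as in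
  \<open>K\<close>.\<close>

lemma CHAR_mpol [simp]: "CHAR(('a::comm_ring_1, 'n) mpol) = CHAR('a)"
proof (rule CHAR_eqI)
  have of_nat: "(of_nat n :: ('a, 'n) mpol) = mconst (of_nat n)" for n
    by (induction n) (simp_all add: mconst_add)
  show "of_nat CHAR('a) = (0 :: ('a, 'n) mpol)"
    by (simp add: of_nat)
  show "CHAR('a) dvd n" if "of_nat n = (0 :: ('a, 'n) mpol)" for n
  proof -
    have "mconst (of_nat n :: 'a) = (mconst 0 :: ('a, 'n) mpol)"
      using that by (simp only: of_nat mconst_0)
    then have "(of_nat n :: 'a) = 0"
      unfolding mconst_def by (metis lookup_single_eq)
    then show ?thesis
      by (simp add: of_nat_eq_0_iff_char_dvd)
  qed
qed

section \<open>The ring of additive polynomials\<close>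

locale frobenius_field =
  fixes q r :: nat and field_type :: "'a::field itself"
  assumes prime_CHAR: "prime CHAR('a)"
    and r_pos: "r \<ge> 1"
    and q_def: "q = CHAR('a) ^ r"
begin

lemma q_gt_1: "q > 1"
proof -
  have "CHAR('a) > 1" using prime_CHAR by (rule prime_gt_1_nat)
  then show ?thesis using r_pos unfolding q_def by (intro one_less_power) auto
qed

lemma q_pow_pos [simp]: "0 < q ^ i"
  using q_gt_1 by simp

lemma zero_q_power [simp]: "(0 :: 'b::semiring_1) ^ (q ^ i) = 0"
  by (intro zero_power q_pow_pos)

text \<open>Stated for any commutative semiring of the right characteristic, because it is applied
  in \<open>K\<close>, in \<open>K[X]\<close> and in the multivariate ring.\<close>

lemma add_q_power:
  fixes x y :: "'b::comm_semiring_1"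
  assumes "CHAR('b) = CHAR('a)"
  shows "(x + y) ^ (q ^ i) = x ^ (q ^ i) + y ^ (q ^ i)"
  by (rule freshmans_dream'[where n = "r * i"]) (use assms prime_CHAR in \<open>auto simp: q_def power_mult\<close>)

lemma K_tau_iff:
  fixes P :: "'a poly"
  shows "P \<in> K_tau q \<longleftrightarrow> (\<forall>k. coeff P k \<noteq> 0 \<longrightarrow> (\<exists>i. k = q ^ i))"
proof
  assume "P \<in> K_tau q"
  then obtain d a where P: "P = (\<Sum>i\<le>d. smult (a i) (tau_pow q i))"
    by (auto simp: K_tau_def)
  show "\<forall>k. coeff P k \<noteq> 0 \<longrightarrow> (\<exists>i. k = q ^ i)"
  proof (intro allI impI)
    fix k assume "coeff P k \<noteq> 0"
    then have "(\<Sum>i\<le>d. coeff (smult (a i) (tau_pow q i)) k) \<noteq> 0"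
      by (simp add: P coeff_sum)
    then obtain i where "coeff (smult (a i) (tau_pow q i)) k \<noteq> 0"
      by (meson sum.neutral)
    then show "\<exists>i. k = q ^ i"
      by (auto simp: tau_pow_def coeff_monom split: if_splits)
  qed
next
  assume *: "\<forall>k. coeff P k \<noteq> 0 \<longrightarrow> (\<exists>i. k = q ^ i)"
  \<comment> \<open>The bound \<open>degree P\<close> is large enough: an exponent
    \<open>q ^ j\<close> that occurs satisfies \<open>j < q ^ j \<le> degree P\<close>.\<close>
  have "P = (\<Sum>i\<le>degree P. smult (coeff P (q ^ i)) (tau_pow q i))"
  proof (rule poly_eqI)
    fix k
    have "coeff (\<Sum>i\<le>degree P. smult (coeff P (q ^ i)) (tau_pow q i)) k
        = (\<Sum>i\<le>degree P. if q ^ i = k then coeff P k else 0)"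
      by (auto simp: coeff_sum tau_pow_def coeff_monom intro!: sum.cong)
    also have "\<dots> = coeff P k"
    proof (cases "coeff P k = 0")
      case True
      then show ?thesis by (auto intro: sum.neutral)
    next
      case False
      then obtain j where j: "k = q ^ j" using * by blast
      have "j < q ^ j" using q_gt_1 by (intro power_gt_expt) auto
      also have "q ^ j \<le> degree P" using False j le_degree by blast
      finally have "j \<le> degree P" by simp
      have "(\<Sum>i\<le>degree P. if q ^ i = k then coeff P k else 0)
          = (\<Sum>i\<le>degree P. if i = j then coeff P k else 0)"
        using q_gt_1 by (intro sum.cong) (auto simp: j)
      then show ?thesis using \<open>j \<le> degree P\<close> by simp
    qed
    finally show "coeff P k = coeff (\<Sum>i\<le>degree P. smult (coeff P (q ^ i)) (tau_pow q i)) k"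
      by simp
  qed
  then show "P \<in> K_tau q"
    unfolding K_tau_def by (intro CollectI exI)
qed

lemma K_tau_0: "(0 :: 'a poly) \<in> K_tau q"
  by (simp add: K_tau_iff)

lemma K_tau_add: "P \<in> K_tau q \<Longrightarrow> Q \<in> K_tau q \<Longrightarrow> P + Q \<in> K_tau q" for P Q :: "'a poly"
  unfolding K_tau_iff by (metis add_0 coeff_add)

lemma K_tau_smult: "P \<in> K_tau q \<Longrightarrow> smult c P \<in> K_tau q" for P :: "'a poly"
  by (auto simp: K_tau_iff)

lemma K_tau_tau_pow: "(tau_pow q i :: 'a poly) \<in> K_tau q"
  by (auto simp: K_tau_iff tau_pow_def coeff_monom split: if_splits)

lemma K_tau_minus: "P \<in> K_tau q \<Longrightarrow> - P \<in> K_tau q" for P :: "'a poly"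
  by (auto simp: K_tau_iff)

lemma K_tau_diff: "P \<in> K_tau q \<Longrightarrow> Q \<in> K_tau q \<Longrightarrow> P - Q \<in> K_tau q" for P Q :: "'a poly"
  using K_tau_add[of P "- Q"] K_tau_minus[of Q] by simp

lemma tau_pow_0: "tau_pow q 0 = [:0, 1 :: 'a:]"
  by (simp add: tau_pow_def monom_altdef)

lemma K_tau_X: "[:0, 1 :: 'a:] \<in> K_tau q"
  using K_tau_tau_pow[of 0] by (simp add: tau_pow_0)

lemma K_tau_induct [consumes 1, case_names zero add tau]:
  fixes P :: "'a poly"
  assumes "P \<in> K_tau q"
    and "R 0" "\<And>P Q. R P \<Longrightarrow> R Q \<Longrightarrow> R (P + Q)"
    and "\<And>c i. R (smult c (tau_pow q i))"
  shows "R P"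
proof -
  have "R (\<Sum>i\<in>A. smult (a i) (tau_pow q i))" for A :: "nat set" and a
    by (induction A rule: infinite_finite_induct) (auto intro: assms)
  then show ?thesis using assms(1) by (auto simp: K_tau_def)
qed

text \<open>\<open>P ^ (q ^ i)\<close> is the product of \<open>\<tau>^i\<close> with
  \<open>P\<close> in \<open>K{\<tau>}\<close>. On \<open>c \<tau>^j\<close> this is the twisted
  rule giving \<open>c ^ (q ^ i)\<close> times \<open>\<tau>^(j + i)\<close>.\<close>

lemma K_tau_power:
  fixes P :: "'a poly"
  assumes "P \<in> K_tau q"
  shows "P ^ (q ^ i) \<in> K_tau q"
  using assms
proof (induction rule: K_tau_induct)
  case zero
  then show ?case by (simp add: K_tau_0)
next
  case (add P Q)
  then show ?case by (simp add: add_q_power K_tau_add)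
next
  case (tau c j)
  have "(smult c (tau_pow q j)) ^ (q ^ i) = smult (c ^ (q ^ i)) (tau_pow q (j + i))"
    by (simp add: smult_power tau_pow_def monom_power power_add)
  then show ?case by (simp add: K_tau_smult K_tau_tau_pow)
qed

lemma pcompose_tau_pow: "pcompose (tau_pow q i) Q = Q ^ (q ^ i)" for Q :: "'a poly"
proof -
  have "pcompose (P ^ n) Q = pcompose P Q ^ n" for P :: "'a poly" and n
    by (induction n) (simp_all add: pcompose_mult pcompose_1)
  then show ?thesis
    by (simp add: tau_pow_def monom_altdef pcompose_pCons)
qed

lemma K_tau_pcompose:
  fixes P Q :: "'a poly"
  assumes "P \<in> K_tau q" "Q \<in> K_tau q"
  shows "pcompose P Q \<in> K_tau q"
  using assms
  by (induction rule: K_tau_induct)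
    (auto simp: K_tau_0 K_tau_add K_tau_smult K_tau_power pcompose_add pcompose_smult
      pcompose_tau_pow)

lemma K_tau_degree:
  fixes P :: "'a poly"
  assumes "P \<in> K_tau q" "P \<noteq> 0"
  obtains i where "degree P = q ^ i"
  using assms by (metis K_tau_iff leading_coeff_0_iff)

section \<open>Right division and principal left ideals\<close>

text \<open>Euclidean division. Degrees are powers of \<open>q\<close>, so whenever
  \<open>degree B \<le> degree A\<close>, some \<open>c \<tau>^(i - j)\<close> composed with
  \<open>B\<close> has the leading term of \<open>A\<close>; subtract and recurse.\<close>

lemma K_tau_right_division:
  fixes A B :: "'a poly"
  assumes "A \<in> K_tau q" "B \<in> K_tau q" "B \<noteq> 0"
  shows "\<exists>Q\<in>K_tau q. A - pcompose Q B = 0 \<or> degree (A - pcompose Q B) < degree B"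
  using assms(1)
proof (induction "degree A" arbitrary: A rule: less_induct)
  case less
  show ?case
  proof (cases "A = 0 \<or> degree A < degree B")
    case True
    then show ?thesis
      by (intro bexI[of _ 0]) (auto simp: K_tau_0)
  next
    case False
    obtain i where i: "degree A = q ^ i" using K_tau_degree less.prems False by blast
    obtain j where j: "degree B = q ^ j" using K_tau_degree assms by blast
    have "j \<le> i" using False i j q_gt_1 by simp
    \<comment> \<open>Composing \<open>\<tau>^(i - j)\<close> with \<open>B\<close> raises the
      leading coefficient of \<open>B\<close> to the power \<open>q ^ (i - j)\<close>, hence the
      denominator.\<close>
    define T where "T = smult (lead_coeff A / lead_coeff B ^ (q ^ (i - j))) (tau_pow q (i - j))"
    have T: "T \<in> K_tau q"
      unfolding T_def by (intro K_tau_smult K_tau_tau_pow)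
    have TB: "pcompose T B = smult (lead_coeff A / lead_coeff B ^ (q ^ (i - j))) (B ^ (q ^ (i - j)))"
      by (simp add: T_def pcompose_smult pcompose_tau_pow)
    have deg: "degree (B ^ (q ^ (i - j))) = q ^ i"
      using assms(3) \<open>j \<le> i\<close> by (simp add: degree_power_eq j flip: power_add)
    have "coeff (pcompose T B) (q ^ i) = lead_coeff A"
      using assms(3) lead_coeff_power[of B "q ^ (i - j)"] by (simp add: TB deg)
    then have "coeff (A - pcompose T B) (q ^ i) = 0" by (simp add: i)
    moreover have "degree (A - pcompose T B) \<le> q ^ i"
      by (rule degree_diff_le) (auto simp: TB i deg)
    ultimately have less': "A - pcompose T B = 0 \<or> degree (A - pcompose T B) < degree A"
      by (metis eq_zero_or_degree_less i)
    show ?thesis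
    proof (cases "A - pcompose T B = 0")
      case True
      then show ?thesis using T by blast
    next
      case False
      have "A - pcompose T B \<in> K_tau q"
        using less.prems T assms(2) by (intro K_tau_diff K_tau_pcompose)
      then obtain Q where Q: "Q \<in> K_tau q"
        "A - pcompose T B - pcompose Q B = 0 \<or> degree (A - pcompose T B - pcompose Q B) < degree B"
        using less.hyps less' False by blast
      then show ?thesis
        by (intro bexI[of _ "T + Q"]) (auto simp: pcompose_add K_tau_add T algebra_simps)
    qed
  qed
qed

text \<open>A nonzero element of least degree generates: the remainder of division by it stays in
  \<open>I\<close> and has smaller degree, so it vanishes.\<close>

lemma K_tau_left_ideal_principal:
  fixes I :: "'a poly set"
  assumes sub: "I \<subseteq> K_tau q" and zero: "0 \<in> I"
    and add: "\<And>P Q. P \<in> I \<Longrightarrow> Q \<in> I \<Longrightarrow> P + Q \<in> I"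
    and comp: "\<And>P Q. P \<in> K_tau q \<Longrightarrow> Q \<in> I \<Longrightarrow> pcompose P Q \<in> I"
  obtains D where "D \<in> I" "\<And>P. P \<in> I \<Longrightarrow> \<exists>Q\<in>K_tau q. P = pcompose Q D"
proof (cases "I = {0}")
  case True
  then show ?thesis
    using K_tau_0 by (intro that[of 0]) auto
next
  case False
  define D where "D = arg_min degree (\<lambda>P. P \<in> I \<and> P \<noteq> 0)"
  obtain P0 where "P0 \<in> I \<and> P0 \<noteq> 0" using False zero by blast
  then have D: "D \<in> I \<and> D \<noteq> 0"
    unfolding D_def by (rule arg_min_natI)
  have min: "degree D \<le> degree P" if "P \<in> I" "P \<noteq> 0" for P
    using that unfolding D_def by (intro arg_min_nat_le) auto
  show ?thesis
  proof (rule that[of D])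
    fix P assume P: "P \<in> I"
    then obtain Q where Q: "Q \<in> K_tau q" "P - pcompose Q D = 0 \<or> degree (P - pcompose Q D) < degree D"
      using K_tau_right_division[of P D] D sub by blast
    have "P + pcompose (- Q) D \<in> I"
      using add comp P D K_tau_minus Q by blast
    then have "P - pcompose Q D \<in> I"
      by (simp add: pcompose_uminus)
    then have "P - pcompose Q D = 0"
      using Q min by force
    then show "\<exists>Q\<in>K_tau q. P = pcompose Q D" using Q by auto
  qed (use D in auto)
qed

section \<open>Additivity of the action of \<open>K{\<tau>}\<close>\<close>

lemma poly_K_tau_0 [simp]: "P \<in> K_tau q \<Longrightarrow> poly P (0 :: 'a) = 0"
  by (induction rule: K_tau_induct) (auto simp: tau_pow_def poly_monom)

lemma poly_K_tau_add: "P \<in> K_tau q \<Longrightarrow> poly P (x + y :: 'a) = poly P x + poly P y"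
  by (induction rule: K_tau_induct)
    (auto simp: tau_pow_def poly_monom add_q_power algebra_simps)

lemma msubst_K_tau_0 [simp]:
  "P \<in> K_tau q \<Longrightarrow> msubst P (0 :: ('a, 'n) mpol) = 0"
  by (induction rule: K_tau_induct)
    (auto simp: msubst_add msubst_smult msubst_tau_pow)

lemma msubst_K_tau_add:
  "P \<in> K_tau q \<Longrightarrow> msubst P (f + g :: ('a, 'n) mpol) = msubst P f + msubst P g"
  by (induction rule: K_tau_induct)
    (auto simp: msubst_add msubst_smult msubst_tau_pow add_q_power algebra_simps)

lemma msubst_K_tau_sum:
  "P \<in> K_tau q \<Longrightarrow> msubst P (\<Sum>a\<in>A. f a :: ('a, 'n) mpol) = (\<Sum>a\<in>A. msubst P (f a))"
  by (induction A rule: infinite_finite_induct) (auto simp: msubst_K_tau_add)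

section \<open>Submodules\<close>

lemma Lam_0: "(0 :: ('a, 'n::finite) mpol) \<in> Lam q"
  unfolding Lam_def by (intro CollectI exI[of _ "\<lambda>_. 0"]) (simp add: K_tau_0)

lemma Lam_add:
  fixes f g :: "('a, 'n::finite) mpol"
  assumes "f \<in> Lam q" "g \<in> Lam q"
  shows "f + g \<in> Lam q"
proof -
  obtain P Q where "\<forall>i. P i \<in> K_tau q" "f = (\<Sum>i\<in>UNIV. msubst (P i) (mvar i))"
    "\<forall>i. Q i \<in> K_tau q" "g = (\<Sum>i\<in>UNIV. msubst (Q i) (mvar i))"
    using assms unfolding Lam_def by blast
  then show ?thesis
    unfolding Lam_def
    by (intro CollectI exI[of _ "\<lambda>i. P i + Q i"]) (auto simp: msubst_add K_tau_add sum.distrib)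
qed

lemma Lam_msubst:
  fixes f :: "('a, 'n::finite) mpol"
  assumes "P \<in> K_tau q" "f \<in> Lam q"
  shows "msubst P f \<in> Lam q"
proof -
  obtain Q where "\<forall>i. Q i \<in> K_tau q" "f = (\<Sum>i\<in>UNIV. msubst (Q i) (mvar i))"
    using assms unfolding Lam_def by blast
  then show ?thesis
    unfolding Lam_def using assms(1)
    by (intro CollectI exI[of _ "\<lambda>i. pcompose P (Q i)"])
      (auto simp: msubst_pcompose K_tau_pcompose msubst_K_tau_sum)
qed

lemma radical_submodule_Mmod:
  fixes F :: "('a ^ 'n::finite) set"
  shows "radical_submodule q (Mmod q F)"
proof -
  have "K_tau_submodule q (Mmod q F)"
    by (auto simp: K_tau_submodule_def Mmod_def Lam_0 Lam_add Lam_msubst)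
  \<comment> \<open>In a field, \<open>f(x) ^ (q ^ N) = 0\<close> forces
    \<open>f(x) = 0\<close>.\<close>
  moreover have "Rad q (Mmod q F) \<subseteq> Mmod q F"
    by (auto simp: Rad_def Mmod_def tau_pow_def poly_monom)
  moreover have "Mmod q F \<subseteq> Rad q (Mmod q F)"
    by (auto simp: Rad_def Mmod_def Lam_msubst K_tau_tau_pow intro!: exI[of _ 0])
  ultimately show ?thesis
    by (auto simp: radical_submodule_def)
qed

text \<open>If \<open>F = Zset S\<close> then \<open>S \<subseteq> Mmod q F\<close>, so every common
  zero of \<open>Mmod q F\<close> is a zero of \<open>S\<close>.\<close>

lemma Zset_Mmod:
  fixes F :: "('a ^ 'n::finite) set"
  assumes "q_variety q F"
  shows "Zset (Mmod q F) = F"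
  using assms unfolding q_variety_def Zset_def Mmod_def by blast

lemma q_variety_Zset:
  "radical_submodule q L \<Longrightarrow> q_variety q (Zset L)" for L :: "('a, 'n::finite) mpol set"
  unfolding radical_submodule_def K_tau_submodule_def q_variety_def by blast

section \<open>Extending partial homomorphisms\<close>

text \<open>
  A \<open>K{\<tau>}\<close>-linear map from a submodule of \<open>\<Lambda>\<^sub>n\<close> to \<open>K\<close> is represented by its graph.
\<close>

definition hom_graph :: "(('a, 'n) mpol \<times> 'a) set \<Rightarrow> bool" where
  "hom_graph G \<longleftrightarrow>
     (0, 0) \<in> G \<and>
     (\<forall>(f, y)\<in>G. \<forall>(g, z)\<in>G. (f + g, y + z) \<in> G) \<and>
     (\<forall>P\<in>K_tau q. \<forall>(f, y)\<in>G. (msubst P f, poly P y) \<in> G) \<and>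
     (\<forall>y. (0, y) \<in> G \<longrightarrow> y = 0)"

lemma hom_graphD:
  assumes "hom_graph G"
  shows "(0, 0) \<in> G"
    and "(f, y) \<in> G \<Longrightarrow> (g, z) \<in> G \<Longrightarrow> (f + g, y + z) \<in> G"
    and "P \<in> K_tau q \<Longrightarrow> (f, y) \<in> G \<Longrightarrow> (msubst P f, poly P y) \<in> G"
    and "(0, y) \<in> G \<Longrightarrow> y = 0"
  using assms unfolding hom_graph_def by blast+

text \<open>Negation is the action of \<open>-X\<close>, an element of
  \<open>K{\<tau>}\<close>.\<close>

lemma hom_graph_minus:
  assumes "hom_graph G" "(f, y) \<in> G"
  shows "(- f, - y) \<in> G"
  using hom_graphD(3)[OF assms(1) K_tau_minus[OF K_tau_X] assms(2)]
  by (simp only: msubst_minus msubst_X) simp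

text \<open>Subtracting two pairs reduces single-valuedness to the value at
  \<open>0\<close>.\<close>

lemma hom_graph_unique:
  assumes "hom_graph G" "(f, y) \<in> G" "(f, z) \<in> G"
  shows "y = z"
  using hom_graphD(4)[OF assms(1), of "y - z"]
    hom_graphD(2)[OF assms(1,2) hom_graph_minus[OF assms(1,3)]] by simp

lemma hom_graph_sum:
  assumes "hom_graph G" "\<And>a. a \<in> A \<Longrightarrow> (f a, y a) \<in> G"
  shows "(\<Sum>a\<in>A. f a, \<Sum>a\<in>A. y a) \<in> G"
  using assms(2)
  by (induction A rule: infinite_finite_induct) (auto intro: hom_graphD[OF assms(1)])

text \<open>The candidate extension of \<open>G\<close> that sends \<open>g\<close> to
  \<open>z\<close>. It is a relation and need not be single-valued; that depends on
  \<open>z\<close>.\<close>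

definition adjoin :: "(('a, 'n) mpol \<times> 'a) set \<Rightarrow> ('a, 'n) mpol \<Rightarrow> 'a \<Rightarrow> (('a, 'n) mpol \<times> 'a) set"
  where "adjoin G g z = {(f + msubst P g, y + poly P z) | f y P. (f, y) \<in> G \<and> P \<in> K_tau q}"

lemma adjoinI: "(f, y) \<in> G \<Longrightarrow> P \<in> K_tau q \<Longrightarrow> (f + msubst P g, y + poly P z) \<in> adjoin G g z"
  unfolding adjoin_def by blast

lemma adjoin_superset: "G \<subseteq> adjoin G g z"
  using adjoinI[OF _ K_tau_0] by fastforce

lemma adjoin_new: "hom_graph G \<Longrightarrow> (g, z) \<in> adjoin G g z"
  using adjoinI[OF hom_graphD(1) K_tau_X, of G g z] by simp

text \<open>
  \<open>D\<close> generates the left ideal of all \<open>P\<close> such that \<open>P \<circ> g\<close> lies in the domain of \<open>G\<close>, so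
  compatibility with \<open>G\<close> at \<open>D\<close> suffices for a value at \<open>g\<close> to be admissible.
\<close>

lemma hom_graph_annihilator:
  fixes g :: "('a, 'n) mpol"
  assumes G: "hom_graph G"
  obtains D w where "D \<in> K_tau q" "(msubst D g, w) \<in> G"
    and "\<And>z. poly D z = w \<Longrightarrow> hom_graph (adjoin G g z)"
proof -
  define I where "I = {P \<in> K_tau q. \<exists>y. (msubst P g, y) \<in> G}"
  obtain D where D: "D \<in> I" and gen: "\<And>P. P \<in> I \<Longrightarrow> \<exists>Q\<in>K_tau q. P = pcompose Q D"
  proof (rule K_tau_left_ideal_principal[of I])
    show "0 \<in> I" using hom_graphD(1)[OF G] by (auto simp: I_def K_tau_0)
    show "P + Q \<in> I" if "P \<in> I" "Q \<in> I" for P Q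
      using that hom_graphD(2)[OF G] unfolding I_def
      by (fastforce simp: msubst_add intro!: K_tau_add)
    show "pcompose P Q \<in> I" if "P \<in> K_tau q" "Q \<in> I" for P Q
      using that hom_graphD(3)[OF G] unfolding I_def
      by (fastforce simp: msubst_pcompose intro!: K_tau_pcompose)
  qed (auto simp: I_def)
  then obtain w where w: "(msubst D g, w) \<in> G" by (auto simp: I_def)
  have "hom_graph (adjoin G g z)" if z: "poly D z = w" for z
    unfolding hom_graph_def
  proof (intro conjI ballI allI impI; clarify?)
    show "(0, 0) \<in> adjoin G g z"
      using hom_graphD(1)[OF G] adjoin_superset by blast
  next
    fix f1 y1 f2 y2
    assume "(f1, y1) \<in> adjoin G g z" "(f2, y2) \<in> adjoin G g z"
    then obtain e1 u1 P1 e2 u2 P2 where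
      "f1 = e1 + msubst P1 g" "y1 = u1 + poly P1 z" "(e1, u1) \<in> G" "P1 \<in> K_tau q"
      "f2 = e2 + msubst P2 g" "y2 = u2 + poly P2 z" "(e2, u2) \<in> G" "P2 \<in> K_tau q"
      unfolding adjoin_def by blast
    then show "(f1 + f2, y1 + y2) \<in> adjoin G g z"
      using adjoinI[of "e1 + e2" "u1 + u2" G "P1 + P2" g z] hom_graphD(2)[OF G] K_tau_add
      by (simp add: msubst_add algebra_simps)
  next
    fix P :: "'a poly" and f y
    assume P: "P \<in> K_tau q" and "(f, y) \<in> adjoin G g z"
    then obtain e u Q where
      "f = e + msubst Q g" "y = u + poly Q z" "(e, u) \<in> G" "Q \<in> K_tau q"
      unfolding adjoin_def by blast
    then show "(msubst P f, poly P y) \<in> adjoin G g z"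
      using adjoinI[of "msubst P e" "poly P u" G "pcompose P Q" g z] hom_graphD(3)[OF G] P
      by (simp add: msubst_K_tau_add poly_K_tau_add msubst_pcompose poly_pcompose K_tau_pcompose)
  next
    \<comment> \<open>Single-valuedness: \<open>e + P \<circ> g = 0\<close> puts
      \<open>P \<circ> g = -e\<close> in the domain of \<open>G\<close>, so
      \<open>P = Q \<circ> D\<close>. Then \<open>-u = Q(w) = Q(D(z)) = P(z)\<close>.\<close>
    fix y assume "(0, y) \<in> adjoin G g z"
    then obtain e u P where *:
      "0 = e + msubst P g" "y = u + poly P z" "(e, u) \<in> G" "P \<in> K_tau q"
      unfolding adjoin_def by blast
    have "msubst P g = - e"
      using *(1) by (metis add.commute eq_neg_iff_add_eq_0)
    then have 1: "(msubst P g, - u) \<in> G"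
      using hom_graph_minus[OF G *(3)] by simp
    then obtain Q where Q: "Q \<in> K_tau q" "P = pcompose Q D"
      using gen *(4) I_def by blast
    have "(msubst P g, poly Q w) \<in> G"
      using hom_graphD(3)[OF G Q(1) w] by (simp add: Q(2) msubst_pcompose)
    with 1 have "- u = poly Q w"
      by (rule hom_graph_unique[OF G])
    also have "\<dots> = poly P z" by (simp add: Q(2) poly_pcompose z)
    finally show "y = 0" using *(2) by (metis add.right_inverse)
  qed
  then show ?thesis using that D w I_def by blast
qed

end

section \<open>Divisibility of \<open>K\<close> and extension of homomorphisms\<close>

locale alg_closed_frobenius_field = frobenius_field q r field_type
  for q r and field_type :: "'a::alg_closed_field itself"
begin

lemma hom_graph_extend:
  fixes g :: "('a, 'n) mpol"
  assumes G: "hom_graph G"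
  obtains z where "hom_graph (adjoin G g z)"
proof -
  obtain D w where D: "D \<in> K_tau q" and w: "(msubst D g, w) \<in> G"
    and ext: "\<And>z. poly D z = w \<Longrightarrow> hom_graph (adjoin G g z)"
    using hom_graph_annihilator[OF G] by blast
  have "\<exists>z. poly D z = w"
  proof (cases "D = 0")
    \<comment> \<open>Here \<open>D \<circ> g = 0\<close>, so \<open>w = 0\<close> by
      single-valuedness and every \<open>z\<close> solves \<open>D(z) = w\<close>.\<close>
    case True
    then show ?thesis using w hom_graphD(4)[OF G] by simp
  next
    case False
    \<comment> \<open>The degree is a power of \<open>q\<close>, hence positive, so
      \<open>D - w\<close> is nonconstant and has a root.\<close>
    then have "degree D > 0" using K_tau_degree[OF D] by (metis q_pow_pos)
    then have "degree (D - [:w:]) > 0"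
      by (metis degree_add_eq_left degree_minus degree_pCons_0 diff_conv_add_uminus)
    then obtain z where "poly (D - [:w:]) z = 0"
      using alg_closed_imp_poly_has_root by blast
    then show ?thesis by auto
  qed
  then show ?thesis using ext that by blast
qed

text \<open>The generators \<open>X_i\<close> are adjoined one at a time; as there are finitely
  many, induction replaces Zorn's lemma.\<close>

lemma hom_graph_extend_mvars:
  assumes "finite A" "hom_graph G"
  shows "\<exists>H x. hom_graph H \<and> G \<subseteq> H \<and> (\<forall>i\<in>A. (mvar i :: ('a, 'n) mpol, x i) \<in> H)"
  using assms(1)
proof (induction A rule: finite_induct)
  case empty
  then show ?case using assms(2) by auto
next
  case (insert i A)
  then obtain H x where H: "hom_graph H" "G \<subseteq> H" "\<forall>i\<in>A. (mvar i, x i) \<in> H"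
    by blast
  obtain z where "hom_graph (adjoin H (mvar i) z)"
    using hom_graph_extend[OF H(1)] by blast
  then show ?case
    using H adjoin_superset[of H "mvar i" z] adjoin_new[OF H(1), of "mvar i" z]
    by (intro exI[of _ "adjoin H (mvar i) z"] exI[of _ "x(i := z)"]) auto
qed

text \<open>With \<open>X_i\<close> sent to \<open>x_i\<close>, linearity sends the sum of the
  \<open>P_i(X_i)\<close> to the sum of the \<open>P_i(x_i)\<close>, which is the value at the point
  \<open>x\<close>.\<close>

lemma hom_graph_evaluation:
  fixes G :: "(('a, 'n::finite) mpol \<times> 'a) set"
  assumes "hom_graph G"
  obtains x where "\<And>f y. f \<in> Lam q \<Longrightarrow> (f, y) \<in> G \<Longrightarrow> meval f x = y"
proof -
  obtain H x where H: "hom_graph H" "G \<subseteq> H" "\<And>i :: 'n. (mvar i, x i) \<in> H"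
    using hom_graph_extend_mvars[OF finite[of "UNIV :: 'n set"] assms] by blast
  show ?thesis
  proof (rule that[of "\<chi> i. x i"])
    fix f y assume f: "f \<in> Lam q" and y: "(f, y) \<in> G"
    obtain P where P: "\<forall>i. P i \<in> K_tau q" "f = (\<Sum>i\<in>UNIV. msubst (P i) (mvar i))"
      using f unfolding Lam_def by blast
    have "(f, \<Sum>i\<in>UNIV. poly (P i) (x i)) \<in> H"
      unfolding P(2)
      by (rule hom_graph_sum[OF H(1)]) (rule hom_graphD(3)[OF H(1) P(1)[rule_format] H(3)])
    moreover have "meval f (\<chi> i. x i) = (\<Sum>i\<in>UNIV. poly (P i) (x i))"
      by (simp add: P(2))
    ultimately show "meval f (\<chi> i. x i) = y"
      using hom_graph_unique[OF H(1)] y H(2) by (metis subsetD)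
  qed
qed

section \<open>Separating points and the Nullstellensatz\<close>

lemma K_tau_nonzero_root:
  fixes D :: "'a poly"
  assumes "D \<in> K_tau q" "\<And>c N. c \<noteq> 0 \<Longrightarrow> D \<noteq> smult c (tau_pow q N)"
  obtains z where "z \<noteq> 0" "poly D z = 0"
proof (cases "D = 0")
  case True
  then show ?thesis using that[of 1] by simp
next
  case False
  \<comment> \<open>Split off the full power of \<open>X\<close>. A constant \<open>E\<close> makes
    \<open>D\<close> a monomial of \<open>K{\<tau>}\<close>, which is excluded; otherwise
    \<open>E\<close> has a root, nonzero because \<open>X\<close> does not divide
    \<open>E\<close>.\<close>
  obtain E where E: "D = [:0, 1:] ^ order 0 D * E" "\<not> [:0, 1:] dvd E"
    using order_decomp[OF False, of 0] by auto
  have "E \<noteq> 0" using E(2) by auto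
  show ?thesis
  proof (cases "degree E = 0")
    case True
    then obtain c where c: "E = [:c:]" by (metis degree_eq_zeroE)
    have "c \<noteq> 0" using c \<open>E \<noteq> 0\<close> by auto
    have D: "D = monom c (order 0 D)"
      using E(1) by (simp add: c monom_altdef)
    have "coeff D (order 0 D) \<noteq> 0"
      using \<open>c \<noteq> 0\<close> by (subst D) simp
    then obtain N where "order 0 D = q ^ N"
      using assms(1) K_tau_iff by blast
    then have "D = smult c (tau_pow q N)"
      using D by (simp add: tau_pow_def smult_monom)
    then show ?thesis using assms(2) \<open>c \<noteq> 0\<close> by blast
  next
    case False
    then obtain z where z: "poly E z = 0"
      using alg_closed_imp_poly_has_root by blast
    have "z \<noteq> 0" using z E(2) by (auto simp: poly_eq_0_iff_dvd)
    moreover have "poly D z = 0" by (subst E(1)) (simp add: z)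
    ultimately show ?thesis by (rule that)
  qed
qed

lemma separating_point:
  fixes L :: "('a, 'n::finite) mpol set"
  assumes L: "K_tau_submodule q L" and f: "f \<in> Lam q" "f \<notin> Rad q L"
  obtains x where "x \<in> Zset L" "meval f x \<noteq> 0"
proof -
  \<comment> \<open>The zero homomorphism on \<open>L\<close>.\<close>
  define G where "G = L \<times> {0 :: 'a}"
  have G: "hom_graph G"
    using L unfolding hom_graph_def G_def K_tau_submodule_def by auto
  obtain D w where D: "D \<in> K_tau q" and w: "(msubst D f, w) \<in> G"
    and ext: "\<And>z. poly D z = w \<Longrightarrow> hom_graph (adjoin G f z)"
    using hom_graph_annihilator[OF G] by blast
  \<comment> \<open>As \<open>w = 0\<close>, every root of \<open>D\<close> is an admissible value
    at \<open>f\<close>; a nonzero one is wanted.\<close>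
  have DL: "msubst D f \<in> L" and "w = 0" using w by (auto simp: G_def)
  obtain z where z: "z \<noteq> 0" "poly D z = 0"
  proof (rule K_tau_nonzero_root[OF D])
    fix c N assume c: "c \<noteq> (0 :: 'a)"
    show "D \<noteq> smult c (tau_pow q N)"
    proof
      assume "D = smult c (tau_pow q N)"
      \<comment> \<open>Scaling by \<open>1 / c\<close> turns \<open>D \<circ> f \<in> L\<close>
        into \<open>\<tau>^N f \<in> L\<close>, contradicting that \<open>f\<close> is outside
        \<open>Rad q L\<close>.\<close>
      then have "pcompose (smult (1 / c) [:0, 1:]) D = tau_pow q N"
        using c by (simp add: pcompose_pCons)
      then have "msubst (tau_pow q N) f = msubst (smult (1 / c) [:0, 1:]) (msubst D f)"
        by (metis msubst_pcompose)
      also have "\<dots> \<in> L"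
        using L DL K_tau_smult[OF K_tau_X] unfolding K_tau_submodule_def by blast
      finally show False using f by (auto simp: Rad_def)
    qed
  qed
  obtain x where x: "\<And>g y. g \<in> Lam q \<Longrightarrow> (g, y) \<in> adjoin G f z \<Longrightarrow> meval g x = y"
    using hom_graph_evaluation[OF ext[of z]] z \<open>w = 0\<close> by blast
  show ?thesis
  proof (rule that[of x])
    show "meval f x \<noteq> 0" using x[OF f(1) adjoin_new[OF G]] z by simp
    have "meval g x = 0" if "g \<in> L" for g
    proof (rule x)
      show "g \<in> Lam q" using that L unfolding K_tau_submodule_def by blast
      show "(g, 0) \<in> adjoin G f z"
        by (rule subsetD[OF adjoin_superset]) (simp add: G_def that)
    qed
    then show "x \<in> Zset L" by (auto simp: Zset_def)
  qed
qed

lemma Mmod_Zset: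
  fixes L :: "('a, 'n::finite) mpol set"
  assumes "radical_submodule q L"
  shows "Mmod q (Zset L) = L"
proof
  show "L \<subseteq> Mmod q (Zset L)"
    using assms unfolding radical_submodule_def K_tau_submodule_def Mmod_def Zset_def by blast
  show "Mmod q (Zset L) \<subseteq> L"
  proof
    fix f assume f: "f \<in> Mmod q (Zset L)"
    \<comment> \<open>Otherwise a separating point would be a zero of \<open>L\<close> at which
      \<open>f\<close> does not vanish.\<close>
    have "f \<in> Rad q L"
      using separating_point[of L f] assms f unfolding radical_submodule_def Mmod_def by blast
    then show "f \<in> L" using assms by (simp add: radical_submodule_def)
  qed
qed

end

theorem theorem3p2:
  fixes p q r :: nat
  assumes "prime p"
    and "CHAR('a::alg_closed_field) = p"
    and "r \<ge> 1" and "q = p ^ r"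
  shows "bij_betw Zset
           {L :: ('a, 'n::finite) mpol set. radical_submodule q L}
           {F :: ('a ^ 'n) set. q_variety q F}
       \<and> bij_betw (Mmod q)
           {F :: ('a ^ 'n) set. q_variety q F}
           {L :: ('a, 'n) mpol set. radical_submodule q L}
       \<and> (\<forall>L :: ('a, 'n) mpol set. radical_submodule q L \<longrightarrow> Mmod q (Zset L) = L)
       \<and> (\<forall>F :: ('a ^ 'n) set. q_variety q F \<longrightarrow> Zset (Mmod q F) = F)"
proof -
  interpret alg_closed_frobenius_field q r "TYPE('a)"
    using assms by unfold_locales auto
  show ?thesis
  proof (intro conjI allI impI)
    show "bij_betw Zset
           {L :: ('a, 'n::finite) mpol set. radical_submodule q L}
           {F :: ('a ^ 'n) set. q_variety q F}"
      by (rule bij_betw_byWitness[where f' = "Mmod q"])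
        (auto simp: Mmod_Zset Zset_Mmod radical_submodule_Mmod q_variety_Zset)
    show "bij_betw (Mmod q)
           {F :: ('a ^ 'n) set. q_variety q F}
           {L :: ('a, 'n) mpol set. radical_submodule q L}"
      by (rule bij_betw_byWitness[where f' = Zset])
        (auto simp: Mmod_Zset Zset_Mmod radical_submodule_Mmod q_variety_Zset)
  qed (simp_all add: Mmod_Zset Zset_Mmod)
qed

end
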